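(* Let $\lambda$ be a nonzero real number. For all integers $n,k\ge0$ with $n\ge k$, \[ S_{J,\lambda}^{(1)}(n,k)=\sum_{m=k}^{n}S_{1,\lambda}(n,m)\,S_{1,\lambda}(m,k). \]
   Context: For a nonzero real $\lambda$, let $\log_\lambda(1+t)=\frac{1}{\lambda}\big((1+t)^\lambda-1\big)$ (the compositional inverse of the degenerate exponential $e_\lambda(t)=(1+\lambda t)^{1/\lambda}$). The degenerate Stirling numbers of the first kind are defined by $\frac{1}{k!}(\log_\lambda(1+t))^k=\sum_{n\ge k}S_{1,\lambda}(n,k)\frac{t^n}{n!}$ for $k\ge0$, and the Jindalrae-Stirling numbers of the first kind by $\frac{1}{k!}\big(\log_\lambda(\log_\lambda(1+t)+1)\big)^k=\sum_{n\ge k}S_{J,\lambda}^{(1)}(n,k)\frac{t^n}{n!}$ for $k\ge0$ (formal power series in $t$). *)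

theory Defs
  imports "HOL-Computational_Algebra.Formal_Power_Series"
begin

text \<open>
  \<open>fps_binomial \<lambda>\<close> is the binomial series of \<open>(1 + t) ^ \<lambda>\<close>, so \<open>deg_log \<lambda>\<close> is the
  series in \<open>t\<close> of \<open>log_\<lambda> (1 + t)\<close>: its variable is the offset from 1. Accordingly
  \<open>log_\<lambda> (1 + u(t))\<close> is \<open>deg_log \<lambda> oo u\<close> for a series \<open>u\<close> without constant term.
\<close>

definition deg_log :: "real \<Rightarrow> real fps" where
  "deg_log l = fps_const (1 / l) * (fps_binomial l - 1)"

text \<open>
  The numbers are read off the exponential generating functions, as \<open>n!\<close> times the coefficient
  of \<open>t ^ n\<close>. Starting the defining series at \<open>n = k\<close> is justified by the vanishing lemmas.
\<close>

definition deg_stirling1 :: "real \<Rightarrow> nat \<Rightarrow> nat \<Rightarrow> real" where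
  "deg_stirling1 l n k = fact n * fps_nth (fps_const (1 / fact k) * deg_log l ^ k) n"

definition jindalrae_stirling1 :: "real \<Rightarrow> nat \<Rightarrow> nat \<Rightarrow> real" where
  "jindalrae_stirling1 l n k =
     fact n * fps_nth (fps_const (1 / fact k) * (deg_log l oo deg_log l) ^ k) n"

lemma deg_log_nth_0 [simp]: "fps_nth (deg_log l) 0 = 0"
  by (simp add: deg_log_def)

lemma deg_stirling1_eq_0: "n < k \<Longrightarrow> deg_stirling1 l n k = 0"
  by (simp add: deg_stirling1_def startsby_zero_power_prefix)

lemma jindalrae_stirling1_eq_0: "n < k \<Longrightarrow> jindalrae_stirling1 l n k = 0"
  by (simp add: jindalrae_stirling1_def startsby_zero_power_prefix)

lemma deg_stirling1_egf:
  "fps_const (1 / fact k) * deg_log l ^ k =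
     Abs_fps (\<lambda>n. if k \<le> n then deg_stirling1 l n k / fact n else 0)"
  by (rule fps_ext) (simp add: deg_stirling1_def startsby_zero_power_prefix)

lemma jindalrae_stirling1_egf:
  "fps_const (1 / fact k) * (deg_log l oo deg_log l) ^ k =
     Abs_fps (\<lambda>n. if k \<le> n then jindalrae_stirling1 l n k / fact n else 0)"
  by (rule fps_ext) (simp add: jindalrae_stirling1_def startsby_zero_power_prefix)

end

theory Submission
  imports Defs
begin

text \<open>Substituting f = \<open>deg_log l\<close>, which has no constant term, respects powers,
  so (f oo f)^k = f^k oo f. Substituting f into f^k/k! = sum of S(m,k) t^m/m! gives the sum of
  S(m,k) f^m/m!, and f^m/m! generates S(n,m).\<close>

theorem theorem4:
  fixes l :: real and n k :: nat
  assumes "l \<noteq> 0" and "k \<le> n"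
  shows "jindalrae_stirling1 l n k = (\<Sum>m=k..n. deg_stirling1 l n m * deg_stirling1 l m k)"
proof -
  let ?d = "deg_log l"
  have "jindalrae_stirling1 l n k = fact n * (1 / fact k) * fps_nth (?d ^ k oo ?d) n"
    by (simp add: jindalrae_stirling1_def fps_compose_power)
  \<comment> \<open>The factor m! of \<open>deg_stirling1 l m k\<close> cancels the 1/m! of
    \<open>deg_stirling1 l n m\<close>.\<close>
  also have "\<dots> = (\<Sum>m=0..n. deg_stirling1 l n m * deg_stirling1 l m k)"
    by (simp add: fps_compose_nth deg_stirling1_def sum_distrib_left sum_divide_distrib mult_ac)
  \<comment> \<open>For m < k the second factor vanishes, since f^k starts at t^k.\<close>
  also have "\<dots> = (\<Sum>m=k..n. deg_stirling1 l n m * deg_stirling1 l m k)"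
    by (rule sum.mono_neutral_right) (auto simp: deg_stirling1_eq_0)
  finally show ?thesis .
qed

end
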